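(* Let $\mathcal{I}\subset\mathbb{K}_{\mathbb{R}}[x_1^{\pm},\ldots,x_n^{\pm}]$ be a linear ideal with constant coefficients and let $M$ be the associated oriented matroid on $\{1,\ldots,n\}$. Let $s\in\{+,-\}^n$ be a pure sign vector. Then $$\mathrm{trop}_{\mathbb{R}}\left(\mathcal{V}(\mathcal{I})\right)\cap\left(s\times\mathbb{R}^n\right)=\mathcal{B}^{s}(M),$$ where $s\times\mathbb{R}^n$ is identified with $\mathbb{R}^n$ and $\mathcal{B}^s(M)$ is the signed Bergman fan of $M$ with respect to $s$.
   Context: **Real tropicalization.** $\mathbb{K}_{\mathbb{R}}=\mathbb{R}\{\{t\}\}$ is the field of real Puiseux series $\sum_{k\ge i}a_kt^{k/N}$ ($i\in\mathbb{Z}$, $N\in\mathbb{N}$, $a_k\in\mathbb{R}$); $\mathrm{val}(a)$ is the lowest exponent of $t$ occurring in $a\ne0$, and the sign $s(a)\in\{+,-\}$ is the sign of the coefficient of $t^{\mathrm{val}(a)}$. Put $\mathrm{trop}_{\mathbb{R}}(a)=(s(a),-\mathrm{val}(a))\in\mathbb{TR}=\{+,-\}\times\mathbb{R}$, applied coordinatewise to tuples. For a variety $X\subset(\mathbb{K}_{\mathbb{R}}^* )^n$, $\mathrm{trop}_{\mathbb{R}}(X)$ is the closure of $\{\mathrm{trop}_{\mathbb{R}}(x):x\in X\}$ in $\mathbb{TR}^n$. For $s\in\{+,-\}^n$, the $s$-chart $s\times\mathbb{R}^n$ is the copy of $\mathbb{R}^n$ in $\mathbb{TR}^n$ of all points with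 signs $s$. $\mathcal{V}(\mathcal{I})\subset(\mathbb{K}_{\mathbb{R}}^* )^n$ is the zero set of $\mathcal{I}$. **Linear ideals and associated oriented matroid.** A linear ideal $\mathcal{I}=\langle l_1,\ldots,l_{n-k}\rangle$ is generated by linear forms $l_i=\sum_j a_{ij}x_j$; it has constant coefficients if the $l_i$ can be chosen with coefficients in $\mathbb{R}$ (where the valuation is trivial). Signed sets $X=(X^+,X^-)$ (disjoint subsets of $\{1,\ldots,n\}$, with support $\underline{X}=X^+\cup X^-$) are identified with sign vectors $s_X\in\{+,-,0\}^n$. The oriented matroid $M$ associated to $\mathcal{I}$ has as signed circuits the signed sets $C$ with $C^{\pm}=\{j:c_j\gtrless0\}$, for nonzero linear forms $\sum_jc_jx_j$ in the real linear span of the $l_i$ whose support $\{j:c_j\ne0\}$ is inclusion-minimal. **Signed Bergman fan.** For $w\in\mathbb{R}^n$ and a signed circuit $C$, the initial circuit $\mathrm{in}_w(C)$ is the signed set with $\mathrm{in}_w(C)^{\pm}=\{j\in C^{\pm}:w_j=\max_{i\in\underline{C}}w_i\}$. The initial matroid $M_w$ is the oriented matroid whose signed circuits are the inclusion-minimal signed sets among all $\mathrm{in}_w(C)$. For sign vectors, $a\subseteq b$ means $a^+\subseteq b^+$ and $a^-\subseteq b^-$. A sign vector is pure if it has no zero entries. An oriented matroid is $s$-acyclic if it has no signed circuit $C$ with $s_C\subseteq s$. The signed Bergman fan is $\mathcal{B}^s(M)=\{w\in\mathbb{R}^n: M_w\text{ is }s\text{-acyclic}\}$. *)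

theory Defs
  imports
    "HOL-Analysis.Analysis"
    "HOL-Computational_Algebra.Formal_Laurent_Series"
    "HOL-Library.Poly_Mapping"
begin

unbundle no fps_syntax

text \<open>
  A real Puiseux series \<open>\<Sum>k\<ge>i. a\<^sub>k t\<^sup>k\<^sup>/\<^sup>N\<close> is represented by its coefficient function on rational exponents.
\<close>

typedef real_puiseux =
  "{f :: rat \<Rightarrow> real. \<exists>N > (0 :: nat). \<exists>i :: int. \<forall>q. f q \<noteq> 0 \<longrightarrow> (\<exists>k \<ge> i. q = of_int k / of_nat N)}"
  morphisms pcoeff Abs_real_puiseux
  by (rule exI[of _ "\<lambda>_. 0"]) auto

lemma real_puiseux_eqI: "(\<And>q. pcoeff a q = pcoeff b q) \<Longrightarrow> a = b"
  by (simp add: pcoeff_inject[symmetric] fun_eq_iff)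

text \<open>Substituting \<open>t\<^sup>1\<^sup>/\<^sup>N\<close> for the variable of a Laurent series.\<close>

definition fls_root :: "nat \<Rightarrow> real fls \<Rightarrow> rat \<Rightarrow> real" where
  "fls_root N F q = (if q * of_nat N \<in> \<int> then fls_nth F \<lfloor>q * of_nat N\<rfloor> else 0)"

definition puiseux_of_fls :: "nat \<Rightarrow> real fls \<Rightarrow> real_puiseux" where
  "puiseux_of_fls N F = Abs_real_puiseux (fls_root N F)"

lemma pcoeff_of_fls:
  assumes "N > 0"
  shows "pcoeff (puiseux_of_fls N F) = fls_root N F"
proof -
  have "\<exists>k \<ge> fls_subdegree F. q = of_int k / of_nat N" if "fls_root N F q \<noteq> 0" for q
  proof -
    from that obtain k where k: "q * of_nat N = of_int k"
      by (auto simp: fls_root_def elim!: Ints_cases split: if_splits)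
    with that have "fls_nth F k \<noteq> 0"
      by (simp add: fls_root_def split: if_splits)
    hence "k \<ge> fls_subdegree F"
      by (rule fls_subdegree_leI)
    moreover have "q = of_int k / of_nat N"
      using k assms by (simp add: field_simps)
    ultimately show ?thesis by blast
  qed
  thus ?thesis
    unfolding puiseux_of_fls_def using assms by (subst Abs_real_puiseux_inverse) auto
qed

lemma fls_root_frac:
  assumes "N > 0"
  shows "fls_root N F (of_int k / of_nat N) = fls_nth F k"
  using assms by (simp add: fls_root_def)

lemma ex_denom: "\<exists>N > 0. \<forall>d > 0. \<exists>F. a = puiseux_of_fls (N * d) F"
proof -
  obtain N :: nat and i :: int where N: "N > 0"
    and i: "\<And>q. pcoeff a q \<noteq> 0 \<Longrightarrow> \<exists>k \<ge> i. q = of_int k / of_nat N"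
    using pcoeff[of a] by blast
  have "\<exists>F. a = puiseux_of_fls (N * d) F" if d: "d > 0" for d
  proof -
    define F where "F = Abs_fls (\<lambda>k. pcoeff a (of_int k / of_nat (N * d)))"
    have supp: "\<exists>k \<ge> i * int d. q = of_int k / of_nat (N * d)" if q: "pcoeff a q \<noteq> 0" for q
    proof -
      obtain k where "k \<ge> i" "q = of_int k / of_nat N"
        using i[OF q] by blast
      thus ?thesis
        using d by (intro exI[of _ "k * int d"]) (auto simp: mult_right_mono)
    qed
    have F: "fls_nth F k = pcoeff a (of_int k / of_nat (N * d))" for k
      unfolding F_def
    proof (rule nth_Abs_fls_ex_lower_bound, intro exI[of _ "i * int d"] allI impI)
      fix k assume k: "k < i * int d"
      show "pcoeff a (of_int k / of_nat (N * d)) = 0"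
      proof (rule ccontr)
        assume "pcoeff a (of_int k / of_nat (N * d)) \<noteq> 0"
        from supp[OF this] obtain l where l: "l \<ge> i * int d"
          "(of_int k :: rat) / of_nat (N * d) = of_int l / of_nat (N * d)" by blast
        have "(of_nat (N * d) :: rat) \<noteq> 0" using N d by simp
        hence "k = l" using l(2) by simp
        with k l show False by simp
      qed
    qed
    have "a = puiseux_of_fls (N * d) F"
    proof (rule real_puiseux_eqI)
      fix q
      show "pcoeff a q = pcoeff (puiseux_of_fls (N * d) F) q"
      proof (cases "q * of_nat (N * d) \<in> \<int>")
        case True
        then obtain k where "q * of_nat (N * d) = of_int k" by (elim Ints_cases)
        hence q: "q = of_int k / of_nat (N * d)"
          using N d by (simp add: field_simps)
        have Nd: "N * d > 0" using N d by simp
        show ?thesis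
          unfolding q pcoeff_of_fls[OF Nd] fls_root_frac[OF Nd] F ..
      next
        case False
        have "pcoeff a q = 0"
          using supp[of q] False N d by force
        thus ?thesis
          using False N d by (simp add: pcoeff_of_fls fls_root_def)
      qed
    qed
    thus ?thesis ..
  qed
  with N show ?thesis by blast
qed

lemma common_denom3:
  obtains N F G H where "N > 0" "a = puiseux_of_fls N F" "b = puiseux_of_fls N G" "c = puiseux_of_fls N H"
proof -
  obtain A B C where A: "A > 0" "\<forall>d > 0. \<exists>F. a = puiseux_of_fls (A * d) F"
    and B: "B > 0" "\<forall>d > 0. \<exists>F. b = puiseux_of_fls (B * d) F"
    and C: "C > 0" "\<forall>d > 0. \<exists>F. c = puiseux_of_fls (C * d) F"
    using ex_denom by metis
  have "\<exists>F. a = puiseux_of_fls (A * B * C) F"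
    using A(2)[rule_format, of "B * C"] B C by (simp add: mult_ac)
  moreover have "\<exists>F. b = puiseux_of_fls (A * B * C) F"
    using B(2)[rule_format, of "A * C"] A C by (simp add: mult_ac)
  moreover have "\<exists>F. c = puiseux_of_fls (A * B * C) F"
    using C(2)[rule_format, of "A * B"] A B by (simp add: mult_ac)
  ultimately show thesis
    using that[of "A * B * C"] A B C by auto
qed

lemma common_denom2:
  obtains N F G where "N > 0" "a = puiseux_of_fls N F" "b = puiseux_of_fls N G"
  using common_denom3[of a b a] by blast

text \<open>The product is the convolution; each of its sums has only finitely many nonzero terms.\<close>

instantiation real_puiseux :: "{zero, one, plus, minus, uminus, times}"
begin

definition zero_real_puiseux where
  "(0 :: real_puiseux) = Abs_real_puiseux (\<lambda>_. 0)"

definition one_real_puiseux where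
  "(1 :: real_puiseux) = Abs_real_puiseux (\<lambda>q. if q = 0 then 1 else 0)"

definition plus_real_puiseux where
  "a + b = Abs_real_puiseux (\<lambda>q. pcoeff a q + pcoeff b q)"

definition minus_real_puiseux where
  "a - b = Abs_real_puiseux (\<lambda>q. pcoeff a q - pcoeff b q)"

definition uminus_real_puiseux where
  "- a = Abs_real_puiseux (\<lambda>q. - pcoeff a q)"

definition times_real_puiseux where
  "a * b = Abs_real_puiseux (\<lambda>q. \<Sum>r | pcoeff a r \<noteq> 0 \<and> pcoeff b (q - r) \<noteq> 0.
     pcoeff a r * pcoeff b (q - r))"

instance ..

end

lemma zero_conv_fls: "0 = puiseux_of_fls N 0"
proof -
  have "fls_root N 0 = (\<lambda>_. 0)" by (simp add: fls_root_def fun_eq_iff)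
  thus ?thesis by (simp add: zero_real_puiseux_def puiseux_of_fls_def)
qed

lemma one_conv_fls:
  assumes "N > 0"
  shows "1 = puiseux_of_fls N 1"
proof -
  have "fls_root N 1 = (\<lambda>q. if q = 0 then 1 else 0)"
    using assms by (auto simp: fls_root_def fun_eq_iff elim!: Ints_cases)
  thus ?thesis
    by (simp add: one_real_puiseux_def puiseux_of_fls_def)
qed

lemma plus_conv_fls:
  assumes "N > 0"
  shows "puiseux_of_fls N F + puiseux_of_fls N G = puiseux_of_fls N (F + G)"
  using assms unfolding plus_real_puiseux_def puiseux_of_fls_def[of N "F + G"]
  by (intro arg_cong[where f = Abs_real_puiseux]) (auto simp: pcoeff_of_fls fls_root_def)

lemma minus_conv_fls:
  assumes "N > 0"
  shows "puiseux_of_fls N F - puiseux_of_fls N G = puiseux_of_fls N (F - G)"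
  using assms unfolding minus_real_puiseux_def puiseux_of_fls_def[of N "F - G"]
  by (intro arg_cong[where f = Abs_real_puiseux]) (auto simp: pcoeff_of_fls fls_root_def)

lemma uminus_conv_fls:
  assumes "N > 0"
  shows "- puiseux_of_fls N F = puiseux_of_fls N (- F)"
  using assms unfolding uminus_real_puiseux_def puiseux_of_fls_def[of N "- F"]
  by (intro arg_cong[where f = Abs_real_puiseux]) (auto simp: pcoeff_of_fls fls_root_def)

lemma fls_times_nth_support:
  "fls_nth (F * G) n = (\<Sum>k | fls_nth F k \<noteq> 0 \<and> fls_nth G (n - k) \<noteq> (0 :: real). fls_nth F k * fls_nth G (n - k))"
  unfolding fls_times_nth(2)
proof (rule sum.mono_neutral_right)
  show "{k. fls_nth F k \<noteq> 0 \<and> fls_nth G (n - k) \<noteq> 0} \<subseteq> {fls_subdegree F..n - fls_subdegree G}"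
  proof
    fix k assume "k \<in> {k. fls_nth F k \<noteq> 0 \<and> fls_nth G (n - k) \<noteq> 0}"
    hence "fls_subdegree F \<le> k" "fls_subdegree G \<le> n - k"
      by (auto intro: fls_subdegree_leI)
    thus "k \<in> {fls_subdegree F..n - fls_subdegree G}" by simp
  qed
qed auto

lemma times_conv_fls:
  assumes N: "N > 0"
  shows "puiseux_of_fls N F * puiseux_of_fls N G = puiseux_of_fls N (F * G)"
proof -
  have "(\<Sum>r | fls_root N F r \<noteq> 0 \<and> fls_root N G (q - r) \<noteq> 0. fls_root N F r * fls_root N G (q - r))
          = fls_root N (F * G) q" (is "sum ?g ?S = _") for q
  proof (cases "q * of_nat N \<in> \<int>")
    case False
    have "?S = {}"
    proof safe
      fix r assume "fls_root N F r \<noteq> 0" "fls_root N G (q - r) \<noteq> 0"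
      hence "r * of_nat N \<in> \<int>" "(q - r) * of_nat N \<in> \<int>"
        by (auto simp: fls_root_def split: if_splits)
      hence "r * of_nat N + (q - r) * of_nat N \<in> \<int>" by (rule Ints_add)
      hence "q * of_nat N \<in> \<int>" by (simp add: algebra_simps)
      with False show "r \<in> {}" by simp
    qed
    moreover have "fls_root N (F * G) q = 0"
      using False by (simp add: fls_root_def)
    ultimately show ?thesis by (simp only: sum.empty)
  next
    case True
    then obtain n where "q * of_nat N = of_int n" by (elim Ints_cases)
    hence q: "q = of_int n / of_nat N" using N by (simp add: field_simps)
    have diff: "q - of_int k / of_nat N = of_int (n - k) / of_nat N" for k
      by (simp add: q diff_divide_distrib)
    let ?h = "\<lambda>k :: int. (of_int k :: rat) / of_nat N"
    let ?T = "{k. fls_nth F k \<noteq> 0 \<and> fls_nth G (n - k) \<noteq> 0}"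
    have inj: "inj_on ?h ?T"
      using N by (auto simp: inj_on_def)
    have im: "?S = ?h ` ?T"
    proof (intro equalityI subsetI)
      fix r assume r: "r \<in> ?S"
      hence "r * of_nat N \<in> \<int>" by (auto simp: fls_root_def split: if_splits)
      then obtain k where "r * of_nat N = of_int k" by (elim Ints_cases)
      hence k: "r = ?h k" using N by (simp add: field_simps)
      have "k \<in> ?T"
        using r unfolding k mem_Collect_eq diff fls_root_frac[OF N] .
      thus "r \<in> ?h ` ?T" using k by blast
    next
      fix r assume "r \<in> ?h ` ?T"
      then obtain k where k: "r = ?h k" "k \<in> ?T" by blast
      show "r \<in> ?S"
        using k(2) unfolding k(1) mem_Collect_eq diff fls_root_frac[OF N] .
    qed
    have "sum ?g ?S = sum (\<lambda>k. fls_nth F k * fls_nth G (n - k)) ?T"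
      unfolding im sum.reindex[OF inj] o_def diff fls_root_frac[OF N] ..
    also have "\<dots> = fls_root N (F * G) q"
      unfolding q fls_root_frac[OF N] fls_times_nth_support ..
    finally show ?thesis .
  qed
  thus ?thesis
    unfolding times_real_puiseux_def pcoeff_of_fls[OF N] by (simp add: puiseux_of_fls_def)
qed

lemma puiseux_of_fls_inject:
  assumes N: "N > 0" and eq: "puiseux_of_fls N F = puiseux_of_fls N G"
  shows "F = G"
proof (rule fls_eqI)
  fix k
  have "fls_root N F (of_int k / of_nat N) = fls_root N G (of_int k / of_nat N)"
    using arg_cong[OF eq, of pcoeff] by (simp add: pcoeff_of_fls[OF N])
  thus "fls_nth F k = fls_nth G k" by (simp only: fls_root_frac[OF N])
qed

instance real_puiseux :: comm_ring_1
proof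
  fix a b c :: real_puiseux
  show "a + b + c = a + (b + c)"
    by (rule common_denom3[of a b c]) (simp add: plus_conv_fls add_ac)
  show "a * b * c = a * (b * c)"
    by (rule common_denom3[of a b c]) (simp add: times_conv_fls mult_ac)
  show "(a + b) * c = a * c + b * c"
    by (rule common_denom3[of a b c]) (simp add: plus_conv_fls times_conv_fls ring_distribs)
  show "a + b = b + a"
    by (rule common_denom2[of a b]) (simp add: plus_conv_fls add_ac)
  show "a * b = b * a"
    by (rule common_denom2[of a b]) (simp add: times_conv_fls mult_ac)
  show "a - b = a + - b"
    by (rule common_denom2[of a b]) (simp add: plus_conv_fls minus_conv_fls uminus_conv_fls)
  show "0 + a = a"
  proof (rule common_denom2[of a a])
    fix N F assume N: "N > (0 :: nat)" and a: "a = puiseux_of_fls N F"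
    show ?thesis unfolding a zero_conv_fls[of N] plus_conv_fls[OF N] by simp
  qed
  show "- a + a = 0"
  proof (rule common_denom2[of a a])
    fix N F assume N: "N > (0 :: nat)" and a: "a = puiseux_of_fls N F"
    show ?thesis unfolding a zero_conv_fls[of N] uminus_conv_fls[OF N] plus_conv_fls[OF N] by simp
  qed
  show "1 * a = a"
  proof (rule common_denom2[of a a])
    fix N F assume N: "N > (0 :: nat)" and a: "a = puiseux_of_fls N F"
    show ?thesis unfolding a one_conv_fls[OF N] times_conv_fls[OF N] by simp
  qed
  show "(0 :: real_puiseux) \<noteq> 1"
    using puiseux_of_fls_inject[of 1 0 1] zero_conv_fls[of 1] one_conv_fls[of 1] by auto
qed

lemma real_puiseux_ex_inverse:
  assumes "a \<noteq> (0 :: real_puiseux)"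
  shows "\<exists>b. a * b = 1"
proof (rule common_denom2[of a a])
  fix N F assume N: "N > (0 :: nat)" and a: "a = puiseux_of_fls N F"
  have "F \<noteq> 0" using assms a zero_conv_fls[of N] by auto
  hence "a * puiseux_of_fls N (inverse F) = 1"
    unfolding a times_conv_fls[OF N] one_conv_fls[OF N] by simp
  thus ?thesis ..
qed

instantiation real_puiseux :: field
begin

definition inverse_real_puiseux where
  "inverse (a :: real_puiseux) = (if a = 0 then 0 else (THE b. a * b = 1))"

definition divide_real_puiseux where
  "(a :: real_puiseux) div b = a * inverse b"

instance
proof
  fix a b :: real_puiseux
  show "inverse a * a = 1" if a: "a \<noteq> 0"
  proof -
    obtain b where b: "a * b = 1" using real_puiseux_ex_inverse[OF a] ..
    have "(THE b. a * b = 1) = b"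
    proof (rule the_equality)
      show "a * b = 1" by (rule b)
    next
      fix c assume "a * c = 1"
      hence "b * (a * c) = b" by simp
      thus "c = b" using b by (metis mult.assoc mult.commute mult_1)
    qed
    thus ?thesis using a b by (simp add: inverse_real_puiseux_def mult.commute)
  qed
qed (simp_all add: inverse_real_puiseux_def divide_real_puiseux_def)

end

definition puiseux_const :: "real \<Rightarrow> real_puiseux" where
  "puiseux_const c = Abs_real_puiseux (\<lambda>q. if q = 0 then c else 0)"

text \<open>Only meaningful for \<open>a \<noteq> 0\<close>, where the exponents occurring in \<open>a\<close> have a least element.\<close>

definition puiseux_val :: "real_puiseux \<Rightarrow> rat" where
  "puiseux_val a = (LEAST q. pcoeff a q \<noteq> 0)"

datatype sign = Plus | Minus

instantiation sign :: discrete_topology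
begin

definition open_sign :: "sign set \<Rightarrow> bool" where
  "open_sign A = True"

instance
  by standard (simp_all add: open_sign_def)

end

definition puiseux_sign :: "real_puiseux \<Rightarrow> sign" where
  "puiseux_sign a = (if pcoeff a (puiseux_val a) > 0 then Plus else Minus)"

type_synonym trop_real = "sign \<times> real"

definition trop_coord :: "real_puiseux \<Rightarrow> trop_real" where
  "trop_coord a = (puiseux_sign a, - real_of_rat (puiseux_val a))"

definition trop_point :: "real_puiseux ^ 'n \<Rightarrow> trop_real ^ 'n" where
  "trop_point x = (\<chi> j. trop_coord (x $ j))"

definition real_trop :: "(real_puiseux ^ 'n) set \<Rightarrow> (trop_real ^ 'n) set" where
  "real_trop X = closure (trop_point ` X)"

definition chart_embed :: "sign ^ 'n \<Rightarrow> real ^ 'n \<Rightarrow> trop_real ^ 'n" where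
  "chart_embed s w = (\<chi> j. (s $ j, w $ j))"

definition chart :: "sign ^ 'n \<Rightarrow> (trop_real ^ 'n) set" where
  "chart s = {p. \<forall>j. fst (p $ j) = s $ j}"

text \<open>Exponent vectors of Laurent monomials are elements of \<open>int ^ 'n\<close>.\<close>

type_synonym 'n laurent = "(int ^ 'n) \<Rightarrow>\<^sub>0 real_puiseux"

definition laurent_eval :: "real_puiseux ^ 'n \<Rightarrow> 'n laurent \<Rightarrow> real_puiseux" where
  "laurent_eval x p = (\<Sum>u \<in> Poly_Mapping.keys p. Poly_Mapping.lookup p u * (\<Prod>j\<in>UNIV. x $ j powi (u $ j)))"

definition torus :: "(real_puiseux ^ 'n) set" where
  "torus = {x. \<forall>j. x $ j \<noteq> 0}"

definition variety :: "'n laurent set \<Rightarrow> (real_puiseux ^ 'n) set" where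
  "variety I = {x \<in> torus. \<forall>p \<in> I. laurent_eval x p = 0}"

definition is_ideal :: "'a :: comm_ring_1 set \<Rightarrow> bool" where
  "is_ideal I \<longleftrightarrow> 0 \<in> I \<and> (\<forall>p \<in> I. \<forall>q \<in> I. p + q \<in> I) \<and> (\<forall>r. \<forall>p \<in> I. r * p \<in> I)"

definition linear_form :: "real_puiseux ^ 'n \<Rightarrow> 'n laurent" where
  "linear_form c = (\<Sum>j\<in>UNIV. Poly_Mapping.single (axis j 1) (c $ j))"

definition const_vec :: "real ^ 'n \<Rightarrow> real_puiseux ^ 'n" where
  "const_vec c = (\<chi> j. puiseux_const (c $ j))"

text \<open>
  A signed set is given as the pair of its positive and its negative part, and an oriented
  matroid on \<open>'n\<close> is given by its set of signed circuits.
\<close>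

type_synonym 'n signed_set = "'n set \<times> 'n set"

definition ssupport :: "'n signed_set \<Rightarrow> 'n set" where
  "ssupport C = fst C \<union> snd C"

definition ssubset_eq :: "'n signed_set \<Rightarrow> 'n signed_set \<Rightarrow> bool" where
  "ssubset_eq C D \<longleftrightarrow> fst C \<subseteq> fst D \<and> snd C \<subseteq> snd D"

definition signed_set_of_pure :: "sign ^ 'n \<Rightarrow> 'n signed_set" where
  "signed_set_of_pure s = ({j. s $ j = Plus}, {j. s $ j = Minus})"

definition form_support :: "real ^ 'n \<Rightarrow> 'n set" where
  "form_support c = {j. c $ j \<noteq> 0}"

definition signed_set_of_form :: "real ^ 'n \<Rightarrow> 'n signed_set" where
  "signed_set_of_form c = ({j. c $ j > 0}, {j. c $ j < 0})"

text \<open>The argument is a set of real linear forms, given by their coefficient vectors.\<close>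

definition signed_circuits_of_forms :: "(real ^ 'n) set \<Rightarrow> 'n signed_set set" where
  "signed_circuits_of_forms L = signed_set_of_form `
     {c \<in> span L. c \<noteq> 0 \<and> \<not> (\<exists>d \<in> span L. d \<noteq> 0 \<and> form_support d \<subset> form_support c)}"

definition initial_circuit :: "real ^ 'n \<Rightarrow> 'n signed_set \<Rightarrow> 'n signed_set" where
  "initial_circuit w C =
     ({j \<in> fst C. w $ j = Max ((\<lambda>i. w $ i) ` ssupport C)},
      {j \<in> snd C. w $ j = Max ((\<lambda>i. w $ i) ` ssupport C)})"

definition initial_matroid :: "real ^ 'n \<Rightarrow> 'n signed_set set \<Rightarrow> 'n signed_set set" where
  "initial_matroid w M = {A \<in> initial_circuit w ` M.
     \<forall>B \<in> initial_circuit w ` M. ssubset_eq B A \<longrightarrow> B = A}"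

definition s_acyclic :: "sign ^ 'n \<Rightarrow> 'n signed_set set \<Rightarrow> bool" where
  "s_acyclic s M \<longleftrightarrow> \<not> (\<exists>C \<in> M. ssubset_eq C (signed_set_of_pure s))"

definition signed_bergman_fan :: "sign ^ 'n \<Rightarrow> 'n signed_set set \<Rightarrow> (real ^ 'n) set" where
  "signed_bergman_fan s M = {w. s_acyclic s (initial_matroid w M)}"

end

theory Submission
  imports Defs
begin

text \<open>
  A form with real coefficients vanishes on a tuple of Puiseux series iff it vanishes on each of its
  coefficient vectors. Looking at the lowest-order coefficient shows that the tropical points satisfy the
  circuit conditions, and failure of such a condition is open in the chart, so the closure satisfies them
  too.

  Conversely, let \<open>w\<close> be in the fan. For each value \<open>a\<close> of \<open>w\<close> there is a real vector \<open>v\<^sub>a\<close> orthogonal to all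
  forms that is zero where \<open>w < a\<close> and has the signs \<open>s\<close> where \<open>w = a\<close>: otherwise a separating hyperplane
  argument gives a form that vanishes where \<open>w > a\<close> and is nonzero and compatible with \<open>s\<close> where \<open>w = a\<close>,
  and such a form of minimal support is a forbidden circuit. If \<open>w\<close> is rational, then \<open>\<Sum>a. v\<^sub>a t\<^sup>-\<^sup>a\<close> lifts \<open>w\<close>;
  in general \<open>w\<close> is the limit of the rational points \<open>\<lfloor>N w\<rfloor> / N\<close>, which eventually have the same order type.
\<close>

(* Defs switches off only the Laurent series bundle of the same name. *)
unbundle no Formal_Power_Series.fps_syntax

section \<open>Evaluation of Laurent polynomials\<close>

lemma laurent_eval_add: "laurent_eval x (p + q) = laurent_eval x p + laurent_eval x q"
  unfolding laurent_eval_def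
  by (rule setsum_keys_plus_distrib) (simp_all add: distrib_right)

lemma laurent_eval_zero: "laurent_eval x 0 = 0"
  by (simp add: laurent_eval_def)

lemma laurent_eval_single:
  "laurent_eval x (Poly_Mapping.single u c) = c * (\<Prod>j\<in>UNIV. x $ j powi (u $ j))"
  by (cases "c = 0") (simp_all add: laurent_eval_def)

lemma laurent_eval_sum: "laurent_eval x (sum f A) = (\<Sum>i\<in>A. laurent_eval x (f i))"
  by (induction A rule: infinite_finite_induct) (simp_all add: laurent_eval_zero laurent_eval_add)

text \<open>Setting the value at a fresh key is the same as adding a monomial. This additive form of
  the induction matches the linearity of evaluation.\<close>

lemma poly_mapping_induct_add [case_names zero single_add]:
  assumes "P 0" and "\<And>u c p. P p \<Longrightarrow> P (Poly_Mapping.single u c + p)"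
  shows "P p"
proof (induction p rule: update_induct)
  case const
  show ?case by (rule assms)
next
  case (update f a b)
  have "Poly_Mapping.update a b f = Poly_Mapping.single a b + f"
    using update(1)
    by (intro poly_mapping_eqI) (auto simp: lookup_update lookup_add lookup_single in_keys_iff)
  with update assms(2) show ?case by simp
qed

text \<open>By linearity in both factors only monomials matter. Exponents may be negative, so
  \<open>powi\<close> is additive in the exponent because the coordinates are nonzero.\<close>

lemma laurent_eval_mult:
  assumes x: "x \<in> torus"
  shows "laurent_eval x (p * q) = laurent_eval x p * laurent_eval x q"
proof (induction p rule: poly_mapping_induct_add)
  case zero
  show ?case by (simp add: laurent_eval_zero)
next
  case (single_add u c p)
  have "laurent_eval x (Poly_Mapping.single u c * q) = laurent_eval x (Poly_Mapping.single u c) * laurent_eval x q"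
  proof (induction q rule: poly_mapping_induct_add)
    case zero
    show ?case by (simp add: laurent_eval_zero)
  next
    case (single_add v d q)
    have "x $ j powi (u $ j + v $ j) = x $ j powi (u $ j) * x $ j powi (v $ j)" for j
      using x by (simp add: torus_def power_int_add)
    hence "laurent_eval x (Poly_Mapping.single u c * Poly_Mapping.single v d) =
      laurent_eval x (Poly_Mapping.single u c) * laurent_eval x (Poly_Mapping.single v d)"
      by (simp add: mult_single laurent_eval_single prod.distrib mult_ac)
    with single_add show ?case
      by (simp add: distrib_left laurent_eval_add)
  qed
  with single_add show ?case
    by (simp add: distrib_right laurent_eval_add)
qed

lemma laurent_eval_linear_form: "laurent_eval x (linear_form c) = (\<Sum>j\<in>UNIV. c $ j * x $ j)"
proof -
  have "(\<Prod>i\<in>UNIV. x $ i powi (axis j 1 $ i)) = x $ j" for j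
  proof -
    have "(\<Prod>i\<in>UNIV. x $ i powi (axis j 1 $ i)) = (\<Prod>i\<in>UNIV. if j = i then x $ i else 1)"
      by (intro prod.cong) (auto simp: axis_def)
    thus ?thesis by simp
  qed
  thus ?thesis
    unfolding linear_form_def laurent_eval_sum laurent_eval_single by simp
qed

text \<open>The Laurent polynomials vanishing at a fixed point of the torus form an ideal, which
  contains the hull as soon as it contains the generators.\<close>

lemma variety_hull:
  "variety (is_ideal hull S) = {x \<in> torus. \<forall>p\<in>S. laurent_eval x p = 0}"
proof -
  have "is_ideal hull S \<subseteq> {p. laurent_eval x p = 0}"
    if "x \<in> torus" "\<forall>p\<in>S. laurent_eval x p = 0" for x
    using that
    by (intro hull_minimal) (auto simp: is_ideal_def laurent_eval_zero laurent_eval_add laurent_eval_mult)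
  thus ?thesis
    unfolding variety_def by (auto intro: hull_inc)
qed

section \<open>Coefficients of Puiseux series\<close>

lemma pcoeff_zero [simp]: "pcoeff 0 q = 0"
  unfolding zero_conv_fls[of 1] by (simp add: pcoeff_of_fls fls_root_def)

lemma pcoeff_add: "pcoeff (a + b) q = pcoeff a q + pcoeff b q"
  by (rule common_denom2[of a b]) (simp add: plus_conv_fls pcoeff_of_fls fls_root_def)

lemma pcoeff_sum: "pcoeff (sum f A) q = (\<Sum>i\<in>A. pcoeff (f i) q)"
  by (induction A rule: infinite_finite_induct) (simp_all add: pcoeff_add)

lemma pcoeff_const: "pcoeff (puiseux_const c) q = (if q = 0 then c else 0)"
proof -
  have "(\<lambda>q :: rat. if q = 0 then c else 0) \<in> {f. \<exists>N > (0 :: nat). \<exists>i :: int. \<forall>q. f q \<noteq> 0 \<longrightarrow>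
      (\<exists>k \<ge> i. q = of_int k / of_nat N)}"
    by (intro CollectI exI[of _ "1 :: nat"] exI[of _ "0 :: int"] conjI allI impI) (simp_all split: if_splits)
  thus ?thesis
    unfolding puiseux_const_def by (simp add: Abs_real_puiseux_inverse)
qed

lemma puiseux_const_conv_fls:
  assumes "N > 0"
  shows "puiseux_const c = puiseux_of_fls N (fls_const c)"
  by (rule real_puiseux_eqI)
    (use assms in \<open>auto simp: pcoeff_const pcoeff_of_fls fls_root_def elim!: Ints_cases\<close>)

lemma pcoeff_const_mult: "pcoeff (puiseux_const c * a) q = c * pcoeff a q"
proof (rule common_denom2[of a a])
  fix N F assume N: "N > (0 :: nat)" and a: "a = puiseux_of_fls N F"
  show ?thesis
    unfolding a puiseux_const_conv_fls[OF N] times_conv_fls[OF N] pcoeff_of_fls[OF N]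
    by (simp add: fls_root_def)
qed

section \<open>Varieties of linear ideals with constant coefficients\<close>

definition coeff_vec :: "real_puiseux ^ 'n \<Rightarrow> rat \<Rightarrow> real ^ 'n" where
  "coeff_vec x q = (\<chi> j. pcoeff (x $ j) q)"

lemma coeff_vec_nth [simp]: "coeff_vec x q $ j = pcoeff (x $ j) q"
  by (simp add: coeff_vec_def)

lemma pcoeff_eval_const_form:
  "pcoeff (laurent_eval x (linear_form (const_vec c))) q = c \<bullet> coeff_vec x q"
  by (simp add: laurent_eval_linear_form const_vec_def pcoeff_sum pcoeff_const_mult inner_vec_def)

lemma orthogonal_span:
  assumes "\<forall>b\<in>B. b \<bullet> v = 0" "c \<in> span B"
  shows "c \<bullet> v = (0 :: real)"
  using assms(2)
  by (induction rule: span_induct_alt) (use assms(1) in \<open>auto simp: inner_add_left\<close>)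

text \<open>Multiplying by constants does not mix exponents, so each equation over the Puiseux
  series splits into one real equation per exponent. Orthogonality to the generators then extends to
  their span.\<close>

lemma variety_constant_linear:
  fixes l :: "'i \<Rightarrow> real ^ 'n"
  assumes "I = is_ideal hull ((\<lambda>i. linear_form (const_vec (l i))) ` A)"
  shows "variety I = {x \<in> torus. \<forall>q. \<forall>c\<in>span (l ` A). c \<bullet> coeff_vec x q = 0}"
proof -
  have "laurent_eval x (linear_form (const_vec c)) = 0 \<longleftrightarrow> (\<forall>q. c \<bullet> coeff_vec x q = 0)" for x and c :: "real ^ 'n"
    unfolding pcoeff_eval_const_form[symmetric]
    using real_puiseux_eqI[of "laurent_eval x (linear_form (const_vec c))" 0] by auto
  moreover have "(\<forall>i\<in>A. \<forall>q. l i \<bullet> coeff_vec x q = 0) \<longleftrightarrow>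
      (\<forall>q. \<forall>c\<in>span (l ` A). c \<bullet> coeff_vec x q = 0)" for x
  proof (intro iffI ballI allI)
    fix q c assume "\<forall>i\<in>A. \<forall>q. l i \<bullet> coeff_vec x q = 0" "c \<in> span (l ` A)"
    thus "c \<bullet> coeff_vec x q = 0" by (intro orthogonal_span[of "l ` A"]) auto
  next
    fix i q assume "\<forall>q. \<forall>c\<in>span (l ` A). c \<bullet> coeff_vec x q = 0" "i \<in> A"
    thus "l i \<bullet> coeff_vec x q = 0" by (simp add: span_base)
  qed
  ultimately show ?thesis
    unfolding assms variety_hull by simp
qed

section \<open>Valuation and leading coefficient\<close>

lemma puiseux_val_eqI:
  assumes "pcoeff a q \<noteq> 0" "\<And>r. r < q \<Longrightarrow> pcoeff a r = 0"
  shows "puiseux_val a = q"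
  unfolding puiseux_val_def using assms by (intro Least_equality) (auto simp: not_less[symmetric])

text \<open>A set of rationals need not have a least element, so \<open>LEAST\<close> has to be
  justified: with a common denominator \<open>N\<close>, the subdegree of the Laurent series divided
  by \<open>N\<close> is the lowest exponent.\<close>

lemma
  assumes "a \<noteq> 0"
  shows pcoeff_val_nonzero: "pcoeff a (puiseux_val a) \<noteq> 0"
    and pcoeff_less_val: "q < puiseux_val a \<Longrightarrow> pcoeff a q = 0"
proof -
  obtain N F where N: "N > 0" and a: "a = puiseux_of_fls N F"
    using common_denom2[of a a] by blast
  have F: "F \<noteq> 0" using assms a zero_conv_fls[of N] by auto
  define q0 :: rat where "q0 = of_int (fls_subdegree F) / of_nat N"
  have nz: "pcoeff a q0 \<noteq> 0"
    unfolding a q0_def pcoeff_of_fls[OF N] fls_root_frac[OF N] using F by simp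
  have less: "pcoeff a r = 0" if "r < q0" for r
  proof (cases "r * of_nat N \<in> \<int>")
    case True
    then obtain k where "r * of_nat N = of_int k" by (elim Ints_cases)
    hence r: "r = of_int k / of_nat N" using N by (simp add: field_simps)
    with that N have "k < fls_subdegree F" by (simp add: q0_def divide_less_cancel)
    thus ?thesis unfolding a r pcoeff_of_fls[OF N] fls_root_frac[OF N] by simp
  qed (simp add: a pcoeff_of_fls[OF N] fls_root_def)
  have "puiseux_val a = q0" using nz less by (rule puiseux_val_eqI)
  with nz less show "pcoeff a (puiseux_val a) \<noteq> 0" "q < puiseux_val a \<Longrightarrow> pcoeff a q = 0"
    by simp_all
qed

section \<open>Circuits as linear forms\<close>

definition sign_real :: "sign \<Rightarrow> real" where
  "sign_real e = (case e of Plus \<Rightarrow> 1 | Minus \<Rightarrow> -1)"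

lemma sign_real_simps [simp]: "sign_real Plus = 1" "sign_real Minus = -1"
  by (simp_all add: sign_real_def)

lemma sign_real_nonzero [simp]: "sign_real e \<noteq> 0"
  by (cases e) simp_all

lemma sign_real_square [simp]: "sign_real e * (sign_real e * y) = y"
  by (cases e) simp_all

text \<open>The forms behind the signed circuits: \<open>signed_circuits_of_forms L\<close> consists
  of the sign patterns of \<open>circuit_forms (span L)\<close>. Vectors, unlike signed sets, can be
  added and scaled.\<close>

definition circuit_forms :: "(real ^ 'n) set \<Rightarrow> (real ^ 'n) set" where
  "circuit_forms V = {c \<in> V. c \<noteq> 0 \<and> \<not> (\<exists>d \<in> V. d \<noteq> 0 \<and> form_support d \<subset> form_support c)}"

lemma signed_bergman_fan_iff:
  fixes M :: "'n :: finite signed_set set"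
  shows "w \<in> signed_bergman_fan s M \<longleftrightarrow>
    (\<forall>C\<in>M. \<not> ssubset_eq (initial_circuit w C) (signed_set_of_pure s))" (is "_ \<longleftrightarrow> ?R")
proof
  assume w: "w \<in> signed_bergman_fan s M"
  show ?R
  proof (intro ballI notI)
    fix C assume C: "C \<in> M" "ssubset_eq (initial_circuit w C) (signed_set_of_pure s)"
    define P where "P A \<longleftrightarrow> A \<in> initial_circuit w ` M \<and> ssubset_eq A (signed_set_of_pure s)" for A
    \<comment> \<open>Total size strictly decreases under proper inclusion of signed sets, so a
      compatible initial circuit of least size is inclusion-minimal.\<close>
    define \<mu> where "\<mu> A = card (fst A) + card (snd A)" for A :: "'n signed_set"
    have "P (initial_circuit w C)" using C by (simp add: P_def)
    then obtain A where A: "P A" and least: "\<And>B. P B \<Longrightarrow> \<mu> A \<le> \<mu> B"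
      using ex_has_least_nat[of P _ \<mu>] by blast
    have "B = A" if B: "B \<in> initial_circuit w ` M" "ssubset_eq B A" for B
    proof -
      have sub: "fst B \<subseteq> fst A" "snd B \<subseteq> snd A" using B(2) by (auto simp: ssubset_eq_def)
      have "P B" using A B by (auto simp: P_def ssubset_eq_def)
      hence "\<mu> A \<le> \<mu> B" by (rule least)
      moreover have "card (fst B) \<le> card (fst A)" "card (snd B) \<le> card (snd A)"
        using sub by (simp_all add: card_mono)
      ultimately have "card (fst B) = card (fst A)" "card (snd B) = card (snd A)"
        by (simp_all add: \<mu>_def)
      hence "fst B = fst A" "snd B = snd A"
        using sub by (simp_all add: card_subset_eq)
      thus ?thesis by (rule prod_eqI)
    qed
    hence "A \<in> initial_matroid w M" using A by (simp add: initial_matroid_def P_def)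
    with A w show False
      by (auto simp: signed_bergman_fan_def s_acyclic_def P_def)
  qed
next
  assume ?R
  thus "w \<in> signed_bergman_fan s M"
    by (auto simp: signed_bergman_fan_def s_acyclic_def initial_matroid_def)
qed

lemma initial_circuit_form_subset_iff:
  fixes c w :: "real ^ 'n"
  shows "ssubset_eq (initial_circuit w (signed_set_of_form c)) (signed_set_of_pure s) \<longleftrightarrow>
    (\<forall>j. c $ j \<noteq> 0 \<and> (\<forall>i. c $ i \<noteq> 0 \<longrightarrow> w $ i \<le> w $ j) \<longrightarrow> 0 < sign_real (s $ j) * c $ j)"
proof -
  have supp: "ssupport (signed_set_of_form c) = {i. c $ i \<noteq> 0}"
    by (auto simp: ssupport_def signed_set_of_form_def)
  have max: "w $ j = Max ((\<lambda>i. w $ i) ` {i. c $ i \<noteq> 0}) \<longleftrightarrow> (\<forall>i. c $ i \<noteq> 0 \<longrightarrow> w $ i \<le> w $ j)"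
    if "c $ j \<noteq> 0" for j
    using that by (subst eq_Max_iff) auto
  have sgn: "0 < sign_real (s $ j) * y \<longleftrightarrow> (0 < y \<longrightarrow> s $ j = Plus) \<and> (y < 0 \<longrightarrow> s $ j = Minus)"
    if "y \<noteq> 0" for j and y
    using that by (cases "s $ j") auto
  show ?thesis
    unfolding ssubset_eq_def initial_circuit_def supp
    by (auto simp: signed_set_of_form_def signed_set_of_pure_def max sgn)
qed

lemma mem_signed_bergman_fan_of_forms:
  "w \<in> signed_bergman_fan s (signed_circuits_of_forms L) \<longleftrightarrow>
    (\<forall>c\<in>circuit_forms (span L).
      \<exists>j. c $ j \<noteq> 0 \<and> (\<forall>i. c $ i \<noteq> 0 \<longrightarrow> w $ i \<le> w $ j) \<and> sign_real (s $ j) * c $ j \<le> 0)"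
  unfolding signed_bergman_fan_iff signed_circuits_of_forms_def circuit_forms_def[symmetric]
  by (auto simp: initial_circuit_form_subset_iff not_less)

section \<open>The tropical points lie in the fan\<close>

lemma sign_real_puiseux_sign:
  assumes "a \<noteq> 0"
  shows "0 < sign_real (puiseux_sign a) * pcoeff a (puiseux_val a)"
  using pcoeff_val_nonzero[OF assms] by (auto simp: puiseux_sign_def)

lemma ex_arg_max_on_support:
  fixes c w :: "real ^ 'n"
  assumes "c \<noteq> 0"
  obtains j where "c $ j \<noteq> 0" "\<And>i. c $ i \<noteq> 0 \<Longrightarrow> w $ i \<le> w $ j"
proof -
  have "{i. c $ i \<noteq> 0} \<noteq> {}" using assms by (auto simp: vec_eq_iff)
  hence "Max ((\<lambda>i. w $ i) ` {i. c $ i \<noteq> 0}) \<in> (\<lambda>i. w $ i) ` {i. c $ i \<noteq> 0}"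
    by (intro Max_in) auto
  then obtain j where "c $ j \<noteq> 0" "w $ j = Max ((\<lambda>i. w $ i) ` {i. c $ i \<noteq> 0})" by auto
  thus ?thesis by (intro that[of j]) auto
qed

text \<open>The lowest-order terms of a vanishing sum must cancel, so they cannot all be
  positive.\<close>

lemma trop_point_initial_form:
  fixes x :: "real_puiseux ^ 'n" and c w :: "real ^ 'n"
  assumes x: "x \<in> torus" and c: "c \<noteq> 0" "\<And>q. c \<bullet> coeff_vec x q = 0"
    and trop: "trop_point x = chart_embed s w"
  shows "\<exists>j. c $ j \<noteq> 0 \<and> (\<forall>i. c $ i \<noteq> 0 \<longrightarrow> w $ i \<le> w $ j) \<and> sign_real (s $ j) * c $ j \<le> 0"
proof (rule ccontr)
  assume contra: "\<not> ?thesis"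
  have nz: "x $ j \<noteq> 0" for j using x by (simp add: torus_def)
  have "trop_coord (x $ j) = (s $ j, w $ j)" for j
    using arg_cong[OF trop, of "\<lambda>p. p $ j"] by (simp add: trop_point_def chart_embed_def)
  hence s: "puiseux_sign (x $ j) = s $ j" and w: "w $ j = - real_of_rat (puiseux_val (x $ j))" for j
    by (simp_all add: trop_coord_def)
  obtain m where m: "c $ m \<noteq> 0" "\<And>i. c $ i \<noteq> 0 \<Longrightarrow> w $ i \<le> w $ m"
    using ex_arg_max_on_support[OF c(1)] by blast
  \<comment> \<open>Since \<open>w\<close> is minus the valuation, this is the lowest valuation over
    the support of \<open>c\<close>.\<close>
  define q where "q = puiseux_val (x $ m)"
  \<comment> \<open>Where \<open>w\<close> is maximal, \<open>q\<close> is the leading exponent of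
    the coordinate, and by \<open>contra\<close> the sign of \<open>c\<close> agrees with the
    leading sign.\<close>
  have pos: "0 < c $ j * pcoeff (x $ j) q" if j: "c $ j \<noteq> 0" "w $ j = w $ m" for j
  proof -
    have "puiseux_val (x $ j) = q" using j(2) by (simp add: w q_def)
    hence "0 < sign_real (s $ j) * pcoeff (x $ j) q"
      using sign_real_puiseux_sign[OF nz[of j]] by (simp add: s)
    moreover have "0 < sign_real (s $ j) * c $ j"
    proof -
      have "\<forall>i. c $ i \<noteq> 0 \<longrightarrow> w $ i \<le> w $ j" using m(2) j(2) by simp
      with contra j(1) show ?thesis by (meson not_le)
    qed
    ultimately have "0 < (sign_real (s $ j) * c $ j) * (sign_real (s $ j) * pcoeff (x $ j) q)"
      by (rule mult_pos_pos[rotated])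
    thus ?thesis by (simp add: mult_ac)
  qed
  \<comment> \<open>Every other coordinate in the support of \<open>c\<close> has larger valuation
    and contributes zero at \<open>q\<close>.\<close>
  have nonneg: "0 \<le> c $ j * pcoeff (x $ j) q" for j
  proof (cases "c $ j \<noteq> 0 \<and> w $ j \<noteq> w $ m")
    case True
    with m(2)[of j] have "q < puiseux_val (x $ j)"
      by (auto simp: w q_def of_rat_less_eq)
    thus ?thesis using pcoeff_less_val[OF nz] by simp
  next
    case False
    thus ?thesis using pos[of j] by (cases "c $ j = 0") (auto intro: less_imp_le)
  qed
  have "0 < (\<Sum>j\<in>UNIV. c $ j * pcoeff (x $ j) q)"
    using nonneg pos[of m] m(1) by (intro sum_pos2[of _ m]) auto
  with c(2)[of q] show False by (simp add: inner_vec_def)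
qed

section \<open>Openness in the chart\<close>

lemma chart_conv_image: "chart s = range (chart_embed s)"
proof (intro equalityI subsetI)
  fix p assume "p \<in> chart s"
  hence "p = chart_embed s (\<chi> j. snd (p $ j))"
    by (simp add: chart_def chart_embed_def vec_eq_iff prod_eq_iff)
  thus "p \<in> range (chart_embed s)" by blast
qed (auto simp: chart_def chart_embed_def)

lemma open_chart: "open (chart s)"
proof -
  have "open ((\<lambda>p :: trop_real ^ 'a. fst (p $ j)) -` {s $ j})" for j
    by (intro open_vimage open_discrete continuous_intros)
  hence "open (\<Inter>j. (\<lambda>p :: trop_real ^ 'a. fst (p $ j)) -` {s $ j})"
    by (intro open_INT) auto
  also have "(\<Inter>j. (\<lambda>p :: trop_real ^ 'a. fst (p $ j)) -` {s $ j}) = chart s"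
    by (auto simp: chart_def)
  finally show ?thesis .
qed

text \<open>If \<open>C\<close> witnesses that \<open>w\<close> is not in the fan, then so it does for all \<open>w'\<close> near \<open>w\<close>, since the
  coordinates at which the maximum over the support of \<open>C\<close> is attained can only become fewer.\<close>

lemma open_chart_embed_not_fan:
  assumes "w \<notin> signed_bergman_fan s (signed_circuits_of_forms L)"
  obtains U where "open U" "chart_embed s w \<in> U" "U \<subseteq> chart s"
    "\<And>w'. chart_embed s w' \<in> U \<Longrightarrow> w' \<notin> signed_bergman_fan s (signed_circuits_of_forms L)"
proof -
  obtain c where c: "c \<in> circuit_forms (span L)"
    and pos: "\<And>j. c $ j \<noteq> 0 \<Longrightarrow> \<forall>i. c $ i \<noteq> 0 \<longrightarrow> w $ i \<le> w $ j \<Longrightarrow> 0 < sign_real (s $ j) * c $ j"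
    using assms unfolding mem_signed_bergman_fan_of_forms not_le[symmetric] by blast
  have "c \<noteq> 0" using c by (simp add: circuit_forms_def)
  then obtain m where m: "c $ m \<noteq> 0" "\<And>i. c $ i \<noteq> 0 \<Longrightarrow> w $ i \<le> w $ m"
    using ex_arg_max_on_support by blast
  \<comment> \<open>On \<open>U\<close> the coordinates in \<open>J\<close> stay strictly below
    coordinate \<open>m\<close>, so no new maximal coordinate can appear in the support of
    \<open>c\<close>.\<close>
  define J where "J = {j. c $ j \<noteq> 0 \<and> w $ j < w $ m}"
  define U where "U = chart s \<inter> (\<Inter>j\<in>J. {p. snd (p $ j) < snd (p $ m)})"
  have "open U"
    unfolding U_def
    by (intro open_Int open_chart open_INT ballI open_Collect_less continuous_intros) auto
  moreover have "chart_embed s w \<in> U"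
    by (auto simp: U_def chart_conv_image) (auto simp: chart_embed_def J_def)
  moreover have "U \<subseteq> chart s" by (simp add: U_def)
  moreover have "w' \<notin> signed_bergman_fan s (signed_circuits_of_forms L)"
    if U: "chart_embed s w' \<in> U" for w'
  proof
    assume "w' \<in> signed_bergman_fan s (signed_circuits_of_forms L)"
    then obtain j where j: "c $ j \<noteq> 0" "\<forall>i. c $ i \<noteq> 0 \<longrightarrow> w' $ i \<le> w' $ j"
        "sign_real (s $ j) * c $ j \<le> 0"
      using c by (auto simp: mem_signed_bergman_fan_of_forms)
    have "j \<notin> J"
    proof
      assume "j \<in> J"
      hence "w' $ j < w' $ m" using U by (simp add: U_def chart_embed_def)
      moreover have "w' $ m \<le> w' $ j" using j(2) m(1) by blast
      ultimately show False by simp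
    qed
    hence "w $ j = w $ m" using m(2)[OF j(1)] j(1) by (auto simp: J_def)
    with pos[OF j(1)] m(2) j(3) show False by auto
  qed
  ultimately show ?thesis by (rule that)
qed

section \<open>Lifting points of the fan\<close>

text \<open>A variant of Farkas' lemma. If \<open>V\<close>, enlarged by all vectors supported on
  \<open>Z\<close>, missed the simplex on the vectors \<open>axis j (\<sigma> $ j)\<close> with
  \<open>j \<in> T\<close>, the normal of a separating hyperplane would be the excluded vector; a
  common point yields the certificate.\<close>

lemma certificate_of_alternative:
  fixes V :: "(real ^ 'n) set" and \<sigma> :: "real ^ 'n"
  assumes V: "subspace V" and \<sigma>: "\<And>j. j \<in> T \<Longrightarrow> \<sigma> $ j \<noteq> 0" and T: "T \<noteq> {}" and disj: "T \<inter> Z = {}"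
    and no_vec: "\<not> (\<exists>v. (\<forall>c\<in>V. c \<bullet> v = 0) \<and> (\<forall>j\<in>Z. v $ j = 0) \<and> (\<forall>j\<in>T. 0 < \<sigma> $ j * v $ j))"
  shows "\<exists>c\<in>V. (\<forall>j. j \<notin> Z \<longrightarrow> j \<notin> T \<longrightarrow> c $ j = 0) \<and> (\<forall>j\<in>T. 0 \<le> \<sigma> $ j * c $ j) \<and> (\<exists>j\<in>T. c $ j \<noteq> 0)"
proof -
  define E where "E = {e :: real ^ 'n. \<forall>j. j \<notin> Z \<longrightarrow> e $ j = 0}"
  define S where "S = {c + e |c e. c \<in> V \<and> e \<in> E}"
  define K where "K = convex hull ((\<lambda>j. axis j (\<sigma> $ j)) ` T)"
  have E: "subspace E" by (auto simp: subspace_def E_def)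
  have S: "subspace S" unfolding S_def by (rule subspace_sums[OF V E])
  have "S \<inter> K \<noteq> {}"
  proof
    assume "S \<inter> K = {}"
    moreover have "K \<noteq> {}" using T by (simp add: K_def)
    moreover have "compact K" by (simp add: K_def finite_imp_compact_convex_hull)
    moreover have "convex K" by (simp add: K_def)
    ultimately obtain a b where a: "\<And>x. x \<in> S \<Longrightarrow> a \<bullet> x < b" "\<And>x. x \<in> K \<Longrightarrow> b < a \<bullet> x"
      using separating_hyperplane_closed_compact[of S K] subspace_imp_convex[OF S] closed_subspace[OF S]
      by blast
    have b: "0 < b" using a(1)[of 0] subspace_0[OF S] by simp
    \<comment> \<open>A linear functional bounded above on a subspace vanishes there; the scaling in
      the proof makes it attain the excluded value \<open>b\<close>.\<close>
    have orth: "a \<bullet> x = 0" if "x \<in> S" for x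
    proof (rule ccontr)
      assume nz: "a \<bullet> x \<noteq> 0"
      have "(b / (a \<bullet> x)) *\<^sub>R x \<in> S" using S that by (rule subspace_scale)
      from a(1)[OF this] nz show False by simp
    qed
    have "\<forall>c\<in>V. c \<bullet> a = 0"
    proof
      fix c assume "c \<in> V"
      hence "c + 0 \<in> S" unfolding S_def using subspace_0[OF E] by blast
      from orth[OF this] show "c \<bullet> a = 0" by (simp add: inner_commute)
    qed
    moreover have "\<forall>j\<in>Z. a $ j = 0"
    proof
      fix j assume "j \<in> Z"
      hence "axis j 1 \<in> E" by (auto simp: E_def axis_def)
      hence "0 + axis j 1 \<in> S" unfolding S_def using subspace_0[OF V] by blast
      from orth[OF this] show "a $ j = 0" by (simp add: inner_axis)
    qed
    moreover have "\<forall>j\<in>T. 0 < \<sigma> $ j * a $ j"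
    proof
      fix j assume "j \<in> T"
      hence "axis j (\<sigma> $ j) \<in> K" unfolding K_def by (intro hull_inc) auto
      from a(2)[OF this] b show "0 < \<sigma> $ j * a $ j" by (simp add: inner_axis mult.commute)
    qed
    ultimately show False using no_vec by blast
  qed
  then obtain c e where c: "c \<in> V" "e \<in> E" "c + e \<in> K" by (auto simp: S_def)
  \<comment> \<open>The quotients \<open>y $ j / \<sigma> $ j\<close> are the convex weights. That
    they sum to 1 later forces a nonzero entry on \<open>T\<close>.\<close>
  have "K \<subseteq> {y. (\<forall>j. j \<notin> T \<longrightarrow> y $ j = 0) \<and> (\<forall>j\<in>T. 0 \<le> \<sigma> $ j * y $ j) \<and> (\<Sum>j\<in>T. y $ j / \<sigma> $ j) = 1}"
    (is "_ \<subseteq> ?Q")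
    unfolding K_def
  proof (rule hull_minimal)
    have "(\<Sum>j\<in>T. axis k (\<sigma> $ k) $ j / \<sigma> $ j) = 1" if "k \<in> T" for k
    proof -
      have "(\<Sum>j\<in>T. axis k (\<sigma> $ k) $ j / \<sigma> $ j) = (\<Sum>j\<in>T. if j = k then 1 else 0)"
        using \<sigma> by (intro sum.cong) (auto simp: axis_def)
      thus ?thesis using that by simp
    qed
    thus "(\<lambda>j. axis j (\<sigma> $ j)) ` T \<subseteq> ?Q"
      by (auto simp: axis_def)
    show "convex ?Q"
      unfolding convex_def
    proof (intro ballI allI impI)
      fix y z and u v :: real
      assume y: "y \<in> ?Q" and z: "z \<in> ?Q" and uv: "0 \<le> u" "0 \<le> v" "u + v = 1"
      have "\<sigma> $ j * (u * y $ j + v * z $ j) = u * (\<sigma> $ j * y $ j) + v * (\<sigma> $ j * z $ j)" for j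
        by (simp add: algebra_simps)
      moreover have "(\<Sum>j\<in>T. (u * y $ j + v * z $ j) / \<sigma> $ j) =
          u * (\<Sum>j\<in>T. y $ j / \<sigma> $ j) + v * (\<Sum>j\<in>T. z $ j / \<sigma> $ j)"
        by (simp add: sum_distrib_left sum.distrib add_divide_distrib)
      ultimately show "u *\<^sub>R y + v *\<^sub>R z \<in> ?Q"
        using y z uv by simp
    qed
  qed
  hence Q: "c + e \<in> ?Q" using c(3) by blast
  \<comment> \<open>The correction \<open>e\<close> lives on \<open>Z\<close>, so off
    \<open>Z\<close>, and in particular on \<open>T\<close>, the conditions on \<open>c + e\<close>
    are conditions on \<open>c\<close>.\<close>
  have eT: "e $ j = 0" if "j \<notin> Z" for j using c(2) that by (auto simp: E_def)
  have cT: "(c + e) $ j = c $ j" if "j \<in> T" for j using eT[of j] disj that by auto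
  show ?thesis
  proof (intro bexI[of _ c] conjI allI ballI impI)
    fix j assume "j \<notin> Z" "j \<notin> T"
    moreover from this have "(c + e) $ j = 0" using Q by blast
    ultimately show "c $ j = 0" using eT[of j] by simp
  next
    fix j assume "j \<in> T"
    thus "0 \<le> \<sigma> $ j * c $ j" using Q cT[of j] by auto
  next
    show "\<exists>j\<in>T. c $ j \<noteq> 0"
    proof (rule ccontr)
      assume "\<not> ?thesis"
      hence "(\<Sum>j\<in>T. (c + e) $ j / \<sigma> $ j) = 0" using cT by (intro sum.neutral) auto
      with Q show False by simp
    qed
  qed (rule c(1))
qed

text \<open>A certificate of minimal support is a circuit: otherwise one could subtract from it a multiple of a
  form of smaller support so as to cancel a further coordinate and keep the sign conditions on \<open>T\<close>.\<close>

lemma circuit_certificate: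
  fixes V :: "(real ^ 'n) set" and \<sigma> :: "real ^ 'n"
  assumes V: "subspace V" and \<sigma>: "\<And>j. j \<in> T \<Longrightarrow> \<sigma> $ j \<noteq> 0"
    and ex: "\<exists>c\<in>V. (\<forall>j. j \<notin> Z \<longrightarrow> j \<notin> T \<longrightarrow> c $ j = 0) \<and> (\<forall>j\<in>T. 0 \<le> \<sigma> $ j * c $ j) \<and> (\<exists>j\<in>T. c $ j \<noteq> 0)"
  shows "\<exists>c\<in>circuit_forms V.
    (\<forall>j. j \<notin> Z \<longrightarrow> j \<notin> T \<longrightarrow> c $ j = 0) \<and> (\<forall>j\<in>T. 0 \<le> \<sigma> $ j * c $ j) \<and> (\<exists>j\<in>T. c $ j \<noteq> 0)"
proof -
  define P where "P c \<longleftrightarrow> c \<in> V \<and> (\<forall>j. j \<notin> Z \<longrightarrow> j \<notin> T \<longrightarrow> c $ j = 0) \<and>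
    (\<forall>j\<in>T. 0 \<le> \<sigma> $ j * c $ j) \<and> (\<exists>j\<in>T. c $ j \<noteq> 0)" for c
  from ex obtain c where c: "P c" and least: "\<And>e. P e \<Longrightarrow> card (form_support c) \<le> card (form_support e)"
    using ex_has_least_nat[of P _ "\<lambda>c. card (form_support c)"] unfolding P_def by blast
  have minimal: "\<not> P e" if "form_support e \<subset> form_support c" for e
    using least[of e] psubset_card_mono[OF _ that] by auto
  have cV: "c \<in> V" and c0: "\<And>j. j \<notin> Z \<Longrightarrow> j \<notin> T \<Longrightarrow> c $ j = 0"
    and cT: "\<And>j. j \<in> T \<Longrightarrow> 0 \<le> \<sigma> $ j * c $ j" and c1: "\<exists>j\<in>T. c $ j \<noteq> 0"
    using c by (auto simp: P_def)
  have False if d: "d \<in> V" "d \<noteq> 0" "form_support d \<subset> form_support c" for d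
  proof -
    have sub: "c $ j \<noteq> 0" if "d $ j \<noteq> 0" for j using d(3) that by (auto simp: form_support_def)
    \<comment> \<open>Coordinate \<open>i\<close> is cancelled, and no new one appears because the
      support of \<open>f\<close> lies in that of \<open>c\<close>.\<close>
    have reduce: "c - r *\<^sub>R f \<in> V \<and> form_support (c - r *\<^sub>R f) \<subset> form_support c \<and>
        (\<forall>j. j \<notin> Z \<longrightarrow> j \<notin> T \<longrightarrow> (c - r *\<^sub>R f) $ j = 0)"
      if "f \<in> V" "form_support f \<subset> form_support c" "c $ i = r * f $ i" "c $ i \<noteq> 0" for f r i
      using that c0 subspace_diff[OF V cV subspace_scale[OF V]]
      by (auto simp: form_support_def)
    show False
    proof (cases "\<forall>j\<in>T. d $ j = 0")
      \<comment> \<open>Here \<open>d\<close> vanishes on \<open>T\<close>, so any coordinate of its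
        support can be cancelled without touching the sign conditions.\<close>
      case True
      obtain i where i: "d $ i \<noteq> 0" using d(2) by (auto simp: vec_eq_iff)
      have r: "c $ i = (c $ i / d $ i) * d $ i" using i by simp
      from reduce[OF d(1,3) r sub[OF i]] have "P (c - (c $ i / d $ i) *\<^sub>R d)"
        using True cT c1 by (auto simp: P_def)
      with reduce[OF d(1,3) r sub[OF i]] minimal show False by blast
    next
      case False
      then obtain k where k: "k \<in> T" "d $ k \<noteq> 0" by blast
      \<comment> \<open>The sign is chosen so that \<open>k\<close> lies in the set \<open>J\<close>
        below, which makes the minimum of ratios exist.\<close>
      define f where "f = (if 0 < \<sigma> $ k * d $ k then d else - d)"
      have f: "f \<in> V" "form_support f \<subset> form_support c"
        using d subspace_neg[OF V] by (auto simp: f_def form_support_def)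
      have "\<sigma> $ k * d $ k \<noteq> 0" using k \<sigma> by simp
      hence "0 < \<sigma> $ k * d $ k \<or> \<sigma> $ k * d $ k < 0" by linarith
      hence fk: "0 < \<sigma> $ k * f $ k" by (auto simp: f_def)
      define J where "J = {j \<in> T. 0 < \<sigma> $ j * f $ j}"
      \<comment> \<open>Ratio test as in the simplex method: the smallest ratio is the largest
        multiple of \<open>f\<close> that can be subtracted before a sign condition on
        \<open>T\<close> breaks.\<close>
      have "Min ((\<lambda>j. c $ j / f $ j) ` J) \<in> (\<lambda>j. c $ j / f $ j) ` J"
        using k fk by (intro Min_in) (auto simp: J_def)
      then obtain i where i: "i \<in> J" "c $ i / f $ i = Min ((\<lambda>j. c $ j / f $ j) ` J)" by auto
      define r where "r = c $ i / f $ i"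
      have r_le: "r \<le> c $ j / f $ j" if "j \<in> J" for j
        unfolding r_def i(2) using that by simp
      have fi: "f $ i \<noteq> 0" "i \<in> T" "0 < \<sigma> $ i * f $ i" using i by (auto simp: J_def)
      have ci: "c $ i \<noteq> 0" using f(2) fi by (auto simp: form_support_def)
      have "0 < \<sigma> $ i * c $ i" using cT[OF fi(2)] ci \<sigma>[OF fi(2)] by (simp add: less_le)
      hence "0 < (\<sigma> $ i * c $ i) / (\<sigma> $ i * f $ i)" using fi(3) by (rule divide_pos_pos)
      also have "\<dots> = r" using \<sigma>[OF fi(2)] by (simp add: r_def)
      finally have r: "0 < r" .
      have cri: "c $ i = r * f $ i" using fi by (simp add: r_def)
      note e = reduce[OF f cri ci]
      have eT: "0 \<le> \<sigma> $ j * (c - r *\<^sub>R f) $ j" if j: "j \<in> T" for j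
      proof (cases "j \<in> J")
        case True
        hence "0 < \<sigma> $ j * f $ j" "f $ j \<noteq> 0" by (auto simp: J_def)
        with r_le[OF True] have "r * (\<sigma> $ j * f $ j) \<le> c $ j / f $ j * (\<sigma> $ j * f $ j)"
          by (intro mult_right_mono) auto
        also have "\<dots> = \<sigma> $ j * c $ j" using \<open>f $ j \<noteq> 0\<close> by simp
        finally show ?thesis by (simp add: algebra_simps)
      next
        case False
        hence "\<sigma> $ j * f $ j \<le> 0" using j by (simp add: J_def not_less)
        hence "r * (\<sigma> $ j * f $ j) \<le> 0" using mult_nonneg_nonpos[OF less_imp_le[OF r]] by blast
        moreover have "0 \<le> \<sigma> $ j * c $ j" by (rule cT[OF j])
        moreover have "\<sigma> $ j * (c - r *\<^sub>R f) $ j = \<sigma> $ j * c $ j - r * (\<sigma> $ j * f $ j)"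
          by (simp add: algebra_simps)
        ultimately show ?thesis by linarith
      qed
      show False
      proof (cases "\<exists>j\<in>T. (c - r *\<^sub>R f) $ j \<noteq> 0")
        case True
        with e eT have "P (c - r *\<^sub>R f)" by (auto simp: P_def)
        with e minimal show False by blast
      next
        \<comment> \<open>If everything on \<open>T\<close> cancels, \<open>f\<close> is there a
          positive multiple of \<open>c\<close>, so \<open>f\<close> itself is a certificate of
          smaller support.\<close>
        case False
        hence "\<forall>j\<in>T. f $ j = c $ j / r" using r by (auto simp: field_simps)
        moreover have "0 \<le> \<sigma> $ j * (c $ j / r)" if "j \<in> T" for j
        proof -
          have "0 \<le> (\<sigma> $ j * c $ j) / r" using cT[OF that] r by (intro divide_nonneg_pos)
          thus ?thesis by simp
        qed
        ultimately have "P f"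
          using f c0 c1 r by (auto simp: P_def form_support_def)
        with f(2) minimal show False by blast
      qed
    qed
  qed
  moreover have "c \<noteq> 0" using c1 by auto
  ultimately have "c \<in> circuit_forms V"
    using cV by (auto simp: circuit_forms_def)
  thus ?thesis using c0 cT c1 by blast
qed

text \<open>The alternative is applied to the level set \<open>T\<close> and the strictly lower set
  \<open>Z\<close>. A circuit certificate has its maximum of \<open>w\<close> on \<open>T\<close>,
  where all its entries are compatible with \<open>s\<close>, contrary to membership in the
  fan.\<close>

lemma fan_leading_vector:
  fixes w :: "real ^ 'n"
  assumes w: "w \<in> signed_bergman_fan s (signed_circuits_of_forms L)"
  shows "\<exists>v. (\<forall>c\<in>span L. c \<bullet> v = 0) \<and> (\<forall>j. w $ j < w $ k \<longrightarrow> v $ j = 0) \<and>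
    (\<forall>j. w $ j = w $ k \<longrightarrow> 0 < sign_real (s $ j) * v $ j)"
proof (rule ccontr)
  assume contra: "\<not> ?thesis"
  define T where "T = {j. w $ j = w $ k}"
  define Z where "Z = {j. w $ j < w $ k}"
  define \<sigma> where "\<sigma> = (\<chi> j. sign_real (s $ j))"
  have \<sigma>: "\<sigma> $ j \<noteq> 0" for j by (simp add: \<sigma>_def)
  have "\<exists>c\<in>span L. (\<forall>j. j \<notin> Z \<longrightarrow> j \<notin> T \<longrightarrow> c $ j = 0) \<and> (\<forall>j\<in>T. 0 \<le> \<sigma> $ j * c $ j) \<and> (\<exists>j\<in>T. c $ j \<noteq> 0)"
    by (rule certificate_of_alternative) (use contra in \<open>auto simp: T_def Z_def \<sigma>_def\<close>)
  from circuit_certificate[OF subspace_span \<sigma> this]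
  obtain c where c: "c \<in> circuit_forms (span L)" "\<And>j. j \<notin> Z \<Longrightarrow> j \<notin> T \<Longrightarrow> c $ j = 0"
    "\<And>j. j \<in> T \<Longrightarrow> 0 \<le> \<sigma> $ j * c $ j" and "\<exists>i\<in>T. c $ i \<noteq> 0" by blast
  then obtain i where i: "w $ i = w $ k" "c $ i \<noteq> 0" by (auto simp: T_def)
  obtain j where j: "c $ j \<noteq> 0" "\<forall>i. c $ i \<noteq> 0 \<longrightarrow> w $ i \<le> w $ j" "sign_real (s $ j) * c $ j \<le> 0"
    using w c(1) by (auto simp: mem_signed_bergman_fan_of_forms)
  \<comment> \<open>The support of \<open>c\<close> meets \<open>T\<close> and lies in
    \<open>Z \<union> T\<close>, so its maximal coordinates lie in \<open>T\<close>. There the two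
    weak inequalities would make the entry at \<open>j\<close> zero.\<close>
  have "w $ k \<le> w $ j" using i j(2) by metis
  hence "j \<in> T"
    using j(1) c(2)[of j] by (cases "j \<in> T") (simp_all add: Z_def)
  with c(3)[OF this] j(1,3) show False by (simp add: \<sigma>_def antisym)
qed

text \<open>The values of \<open>w\<close> are replaced by multiples of \<open>1/N\<close> in the same order, and the leading vectors
  become the coefficient vectors of a point of the variety.\<close>

lemma fan_lift:
  fixes w :: "real ^ 'n"
  assumes w: "w \<in> signed_bergman_fan s (signed_circuits_of_forms L)"
    and N: "N > 0" and sep: "\<And>i j. w $ i < w $ j \<Longrightarrow> \<lfloor>of_nat N * w $ i\<rfloor> < \<lfloor>of_nat N * w $ j\<rfloor>"
  shows "\<exists>x\<in>torus. (\<forall>q. \<forall>c\<in>span L. c \<bullet> coeff_vec x q = 0) \<and>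
    trop_point x = chart_embed s (\<chi> j. of_int \<lfloor>of_nat N * w $ j\<rfloor> / of_nat N)"
proof -
  define A where "A = range (\<lambda>k. w $ k)"
  have "\<forall>a\<in>A. \<exists>v. (\<forall>c\<in>span L. c \<bullet> v = 0) \<and> (\<forall>j. w $ j < a \<longrightarrow> v $ j = 0) \<and>
    (\<forall>j. w $ j = a \<longrightarrow> 0 < sign_real (s $ j) * v $ j)"
    using fan_leading_vector[OF w] by (auto simp: A_def)
  from bchoice[OF this] obtain v where v0: "\<forall>a\<in>A. (\<forall>c\<in>span L. c \<bullet> v a = 0) \<and> (\<forall>j. w $ j < a \<longrightarrow> v a $ j = 0) \<and>
    (\<forall>j. w $ j = a \<longrightarrow> 0 < sign_real (s $ j) * v a $ j)"
    by (elim exE)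
  have v: "c \<bullet> v a = 0" "w $ j < a \<Longrightarrow> v a $ j = 0" if "a \<in> A" "c \<in> span L" for a c j
    using bspec[OF v0 that(1)] that(2) by simp_all
  have v_sign: "0 < sign_real (s $ j) * v (w $ j) $ j" for j
    using bspec[OF v0, of "w $ j"] by (simp add: A_def)
  \<comment> \<open>The minus sign undoes the one in \<open>trop_coord\<close>: larger values of
    \<open>w\<close> get lower exponents.\<close>
  define ex :: "real \<Rightarrow> rat" where "ex a = of_int (- \<lfloor>of_nat N * a\<rfloor>) / of_nat N" for a
  have ex_less: "ex b < ex a" if "a \<in> A" "b \<in> A" "a < b" for a b
    using that sep N by (auto simp: A_def ex_def divide_less_cancel)
  have A: "finite A" by (simp add: A_def)
  \<comment> \<open>As \<open>ex\<close> is injective on \<open>A\<close>, each sum has at most one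
    term; the empty sum supplies zero at all other exponents.\<close>
  define g where "g q = (\<Sum>a\<in>{a\<in>A. ex a = q}. v a)" for q
  define x where "x = (\<chi> j. Abs_real_puiseux (\<lambda>q. g q $ j))"
  have pc: "pcoeff (x $ j) q = g q $ j" for j q
  proof -
    \<comment> \<open>All exponents have denominator \<open>N\<close>, and finiteness of
      \<open>A\<close> bounds their numerators from below, so \<open>g\<close> is a Puiseux series
      in each coordinate.\<close>
    define i where "i = Min ((\<lambda>a. - \<lfloor>of_nat N * a\<rfloor>) ` A)"
    have "\<exists>k\<ge>i. q = of_int k / of_nat N" if "g q $ j \<noteq> 0" for q
    proof -
      from that have "{a\<in>A. ex a = q} \<noteq> {}" unfolding g_def by (intro notI) simp
      then obtain a where "a \<in> A" "ex a = q" by blast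
      thus ?thesis using A by (intro exI[of _ "- \<lfloor>of_nat N * a\<rfloor>"]) (auto simp: ex_def i_def)
    qed
    thus ?thesis
      unfolding x_def using N by (simp, subst Abs_real_puiseux_inverse) auto
  qed
  have lead: "g (ex (w $ j)) $ j = v (w $ j) $ j" for j
  proof -
    have wj: "w $ j \<in> A" by (simp add: A_def)
    have "a = w $ j" if "a \<in> A" "ex a = ex (w $ j)" for a
      using ex_less[OF wj that(1)] ex_less[OF that(1) wj] that(2)
      by (cases a "w $ j" rule: linorder_cases) simp_all
    hence "{a\<in>A. ex a = ex (w $ j)} = {w $ j}" using wj by auto
    thus ?thesis by (simp add: g_def)
  qed
  \<comment> \<open>An exponent below \<open>ex (w $ j)\<close> belongs to a value \<open>a\<close>
    above \<open>w $ j\<close>, and \<open>v a\<close> vanishes at \<open>j\<close> by its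
    choice.\<close>
  have low: "g q $ j = 0" if "q < ex (w $ j)" for q j
  proof -
    have "v a $ j = 0" if "a \<in> A" "ex a = q" for a
    proof (rule v(2)[OF that(1) span_zero], rule ccontr)
      assume "\<not> w $ j < a"
      hence "ex (w $ j) \<le> ex a"
        using ex_less[of a "w $ j"] that(1) by (cases "a = w $ j") (auto simp: A_def)
      with that \<open>q < ex (w $ j)\<close> show False by simp
    qed
    thus ?thesis by (simp add: g_def sum_component)
  qed
  have nz: "v (w $ j) $ j \<noteq> 0" for j using v_sign[of j] by auto
  have val: "puiseux_val (x $ j) = ex (w $ j)" for j
    by (rule puiseux_val_eqI) (simp_all add: pc lead nz low)
  have "puiseux_sign (x $ j) = s $ j" for j
    unfolding puiseux_sign_def val pc lead using v_sign[of j] by (cases "s $ j") auto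
  hence "trop_point x = chart_embed s (\<chi> j. of_int \<lfloor>of_nat N * w $ j\<rfloor> / of_nat N)"
    by (simp add: trop_point_def chart_embed_def trop_coord_def val ex_def vec_eq_iff of_rat_divide of_rat_minus)
  moreover have "x \<in> torus"
  proof -
    have "x $ j \<noteq> 0" for j
    proof
      assume "x $ j = 0"
      hence "g (ex (w $ j)) $ j = 0" using pc[of j "ex (w $ j)"] by simp
      with lead nz show False by simp
    qed
    thus ?thesis by (simp add: torus_def)
  qed
  moreover have "c \<bullet> coeff_vec x q = 0" if "c \<in> span L" for q c
  proof -
    have "coeff_vec x q = g q" by (simp add: vec_eq_iff pc)
    thus ?thesis using that v(1) by (simp add: g_def inner_sum_right)
  qed
  ultimately show ?thesis by blast
qed

section \<open>Rational approximation preserving the order of the entries\<close>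

lemma floor_separation:
  fixes w :: "real ^ 'n"
  shows "\<forall>\<^sub>F N in sequentially. \<forall>i j. w $ i < w $ j \<longrightarrow> \<lfloor>of_nat N * w $ i\<rfloor> < \<lfloor>of_nat N * w $ j\<rfloor>"
proof -
  have "\<forall>\<^sub>F N in sequentially. \<lfloor>of_nat N * a\<rfloor> < \<lfloor>of_nat N * b\<rfloor>" if "a < b" for a b :: real
  proof -
    \<comment> \<open>From here on the scaled gap is at least 1, which forces different
      floors.\<close>
    have "\<forall>\<^sub>F N in sequentially. 1 / (b - a) \<le> of_nat N"
      using filterlim_real_sequentially by (simp add: filterlim_at_top)
    thus ?thesis
    proof eventually_elim
      case (elim N)
      hence "1 \<le> of_nat N * (b - a)"
        using that by (simp add: divide_le_eq)
      hence "of_nat N * a + 1 \<le> of_nat N * b"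
        by (simp add: algebra_simps)
      hence "\<lfloor>of_nat N * a + 1\<rfloor> \<le> \<lfloor>of_nat N * b\<rfloor>" by (rule floor_mono)
      thus ?case by simp
    qed
  qed
  hence "\<forall>\<^sub>F N in sequentially. w $ i < w $ j \<longrightarrow> \<lfloor>of_nat N * w $ i\<rfloor> < \<lfloor>of_nat N * w $ j\<rfloor>" for i j
    by (cases "w $ i < w $ j") simp_all
  thus ?thesis
    by (intro eventually_all_finite)
qed

lemma floor_approx_tendsto: "(\<lambda>N. of_int \<lfloor>of_nat N * a\<rfloor> / of_nat N) \<longlonglongrightarrow> (a :: real)"
proof (rule tendsto_sandwich)
  show "(\<lambda>N. a - 1 / of_nat N) \<longlonglongrightarrow> a"
    using tendsto_diff[OF tendsto_const[of a] lim_1_over_n] by simp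
  show "\<forall>\<^sub>F N in sequentially. a - 1 / of_nat N \<le> of_int \<lfloor>of_nat N * a\<rfloor> / of_nat N"
    using eventually_gt_at_top[of 0]
  proof eventually_elim
    case (elim N)
    have "of_nat N * a - 1 \<le> of_int \<lfloor>of_nat N * a\<rfloor>" by linarith
    hence "(of_nat N * a - 1) / of_nat N \<le> of_int \<lfloor>of_nat N * a\<rfloor> / of_nat N"
      by (rule divide_right_mono) simp
    with elim show ?case by (simp add: diff_divide_distrib)
  qed
  show "\<forall>\<^sub>F N in sequentially. of_int \<lfloor>of_nat N * a\<rfloor> / of_nat N \<le> a"
    using eventually_gt_at_top[of 0]
  proof eventually_elim
    case (elim N)
    have "of_int \<lfloor>of_nat N * a\<rfloor> \<le> of_nat N * a" by linarith
    with elim show ?case by (simp add: field_simps)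
  qed
qed simp

theorem theorem2p2p16:
  fixes l :: "nat \<Rightarrow> real ^ 'n" and m :: nat
    and I :: "'n laurent set" and M :: "'n signed_set set" and s :: "sign ^ 'n"
  assumes "I = is_ideal hull ((\<lambda>i. linear_form (const_vec (l i))) ` {..<m})"
    and "M = signed_circuits_of_forms (l ` {..<m})"
  shows "real_trop (variety I) \<inter> chart s = chart_embed s ` signed_bergman_fan s M"
proof (intro equalityI subsetI)
  note var = variety_constant_linear[OF assms(1)]
  fix p assume p: "p \<in> real_trop (variety I) \<inter> chart s"
  then obtain w where w: "p = chart_embed s w" by (auto simp: chart_conv_image)
  have "w \<in> signed_bergman_fan s M"
  proof (rule ccontr)
    assume "w \<notin> signed_bergman_fan s M"
    then obtain U where U: "open U" "p \<in> U" "U \<subseteq> chart s"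
      and not_fan: "\<And>w'. chart_embed s w' \<in> U \<Longrightarrow> w' \<notin> signed_bergman_fan s M"
      unfolding assms(2) w by (rule open_chart_embed_not_fan) blast
    \<comment> \<open>A neighbourhood of a closure point contains a genuine tropical point, to which
      the circuit conditions apply directly.\<close>
    have "U \<inter> trop_point ` variety I \<noteq> {}"
      using p U(1,2) open_Int_closure_eq_empty[of U "trop_point ` variety I"]
      by (auto simp: real_trop_def)
    then obtain x where x: "x \<in> variety I" "trop_point x \<in> U" by blast
    with U(3) obtain w' where w': "trop_point x = chart_embed s w'" by (auto simp: chart_conv_image)
    have "w' \<in> signed_bergman_fan s M"
      unfolding assms(2) mem_signed_bergman_fan_of_forms
      using x(1) w' by (intro ballI trop_point_initial_form) (auto simp: var circuit_forms_def)
    with not_fan x(2) w' show False by simp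
  qed
  thus "p \<in> chart_embed s ` signed_bergman_fan s M" using w by blast
next
  note var = variety_constant_linear[OF assms(1)]
  fix p assume "p \<in> chart_embed s ` signed_bergman_fan s M"
  then obtain w where w: "w \<in> signed_bergman_fan s M" "p = chart_embed s w" by blast
  define W where "W N = chart_embed s (\<chi> j. of_int \<lfloor>of_nat N * w $ j\<rfloor> / of_nat N)" for N
  \<comment> \<open>Once \<open>N\<close> is positive and the floors keep the strict order of the
    entries of \<open>w\<close>, \<open>W N\<close> lifts to a point of the variety.\<close>
  have "\<forall>\<^sub>F N in sequentially. W N \<in> real_trop (variety I)"
    using floor_separation[of w] eventually_gt_at_top[of 0]
  proof eventually_elim
    case (elim N)
    with fan_lift[of w s "l ` {..<m}" N] w(1)[unfolded assms(2)] obtain x where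
      "x \<in> variety I" "trop_point x = W N"
      unfolding var W_def by blast
    thus ?case
      unfolding real_trop_def by (intro subsetD[OF closure_subset] image_eqI[of _ _ x]) simp_all
  qed
  moreover have "W \<longlonglongrightarrow> p"
    unfolding w(2) chart_embed_def W_def
    by (intro vec_tendstoI) (simp add: tendsto_Pair floor_approx_tendsto)
  ultimately have "p \<in> real_trop (variety I)"
    by (intro Lim_in_closed_set[of _ W sequentially]) (simp_all add: real_trop_def)
  thus "p \<in> real_trop (variety I) \<inter> chart s"
    using w(2) by (simp add: chart_conv_image)
qed

end
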